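(* Let $p$ be an odd prime. Then for any integer $0\le r\le p^2$, there exists an ordered pair $(a,b)$ of nonnegative integers such that $$\binom{p^2}{r}=a\binom{p^2}{1}+b\binom{p^2}{p}.$$ In particular, we have the following congruence relation $$\binom{p^2}{r}\equiv bp\pmod{p^2}.$$
   Context: Here $\binom{n}{k}$ denotes the usual binomial coefficient. In the congruence, $b$ is the second entry of the pair $(a,b)$ from the first part of the claim.
   Formalization: The range 0 ≤ r ≤ p² is replaced by 0 < r < p², since at r = 0 and r = p² the binomial coefficient is 1 while p divides both C(p²,1) and C(p²,p), so neither the representation nor the congruence can hold there. *)

theory Defs
  imports "HOL-Number_Theory.Number_Theory"
begin

text \<open>
  The source states the claim for \<open>0 \<le> r \<le> p^2\<close>. It fails at the two endpoints, where the
  binomial coefficient is 1 while \<open>p\<close> divides both generators; the following lemma records this.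
  The main statement therefore ranges over \<open>0 < r < p^2\<close>.
\<close>

lemma no_representation_at_endpoints:
  fixes p r a b :: nat
  assumes "prime p" and "r = 0 \<or> r = p\<^sup>2"
  shows "p\<^sup>2 choose r \<noteq> a * (p\<^sup>2 choose 1) + b * (p\<^sup>2 choose p)"
proof
  assume eq: "p\<^sup>2 choose r = a * (p\<^sup>2 choose 1) + b * (p\<^sup>2 choose p)"
  have "p > 0" using assms(1) by (rule prime_gt_0_nat)
  have "p * (p\<^sup>2 choose p) = p\<^sup>2 * ((p\<^sup>2 - 1) choose (p - 1))"
    using times_binomial_minus1_eq[OF \<open>p > 0\<close>, of "p\<^sup>2"] .
  hence "p\<^sup>2 choose p = p * ((p\<^sup>2 - 1) choose (p - 1))"
    using \<open>p > 0\<close> by (simp add: power2_eq_square)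
  hence "p dvd p\<^sup>2 choose p" by simp
  moreover have "p dvd p\<^sup>2 choose 1" by simp
  ultimately have "p dvd p\<^sup>2 choose r" unfolding eq by simp
  moreover have "p\<^sup>2 choose r = 1" using assms(2) by auto
  ultimately show False using assms(1) by (simp add: prime_nat_iff)
qed

end

theory Submission
  imports Defs
begin

text \<open>
  Every \<open>p\<^sup>2 choose r\<close> with \<open>0 < r < p\<^sup>2\<close> is a multiple of \<open>p\<close>, and \<open>p\<^sup>2 choose p\<close> is congruent
  to \<open>p\<close> modulo \<open>p\<^sup>2\<close>, so \<open>b = ((p\<^sup>2 choose r) div p) mod p\<close> satisfies both
  congruences modulo \<open>p\<^sup>2\<close>.
  What remains is that \<open>a\<close> be nonnegative. If \<open>p\<close> does not divide \<open>r\<close> then \<open>b = 0\<close>, and if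
  \<open>r\<close> is \<open>p\<close> or \<open>p\<^sup>2 - p\<close> then \<open>b = 1\<close>. Any other \<open>r\<close> is at distance at least \<open>p + 2\<close> from
  both \<open>0\<close> and \<open>p\<^sup>2\<close>, and two steps of Pascal's ratio beyond \<open>p\<close> already gain a
  factor \<open>p - 1 \<ge> b\<close>.
\<close>

text \<open>Absorption makes \<open>p ^ n\<close> divide \<open>k * (p ^ n choose k)\<close>. If the
  binomial were prime to \<open>p\<close>, all of \<open>p ^ n\<close> would have to divide the
  smaller positive \<open>k\<close>.\<close>

lemma prime_dvd_prime_power_choose:
  fixes p n k :: nat
  assumes "prime p" and "0 < k" and "k < p ^ n"
  shows "p dvd p ^ n choose k"
proof (rule ccontr)
  assume "\<not> p dvd p ^ n choose k"
  then have "coprime (p ^ n) (p ^ n choose k)"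
    using assms(1) by (simp add: prime_imp_coprime)
  moreover have "p ^ n dvd k * (p ^ n choose k)"
    using times_binomial_minus1_eq[OF assms(2), of "p ^ n"] by simp
  ultimately have "p ^ n dvd k"
    using coprime_dvd_mult_left_iff by blast
  then show False using assms(2,3) by (auto dest: dvd_imp_le)
qed

text \<open>The same absorption identity, with \<open>k\<close> now the factor coprime to
  \<open>p ^ n\<close>.\<close>

lemma prime_power_dvd_choose_of_not_dvd:
  fixes p n k :: nat
  assumes "prime p" and "\<not> p dvd k"
  shows "p ^ n dvd p ^ n choose k"
proof -
  have "0 < k" using assms(2) by (auto intro: Nat.gr0I)
  then have "p ^ n dvd k * (p ^ n choose k)"
    using times_binomial_minus1_eq[of k "p ^ n"] by simp
  moreover have "coprime (p ^ n) k"
    using assms by (simp add: prime_imp_coprime)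
  ultimately show ?thesis
    using coprime_dvd_mult_right_iff by blast
qed

text \<open>By Pascal's rule, neighbours in row \<open>p ^ n - 1\<close> add up to an inner entry of
  row \<open>p ^ n\<close>, hence to 0 modulo \<open>p\<close>; so the signs alternate from
  1.\<close>

lemma prime_power_minus_one_choose_cong:
  fixes p n k :: nat
  assumes "prime p" and "k < p ^ n"
  shows "[int ((p ^ n - 1) choose k) = (- 1) ^ k] (mod int p)"
  using assms(2)
proof (induction k)
  case 0
  then show ?case by simp
next
  case (Suc k)
  have "p ^ n = Suc (p ^ n - 1)" using Suc.prems by simp
  then have pascal: "p ^ n choose Suc k = ((p ^ n - 1) choose k) + ((p ^ n - 1) choose Suc k)"
    by (metis binomial_Suc_Suc)
  have "int p dvd int (p ^ n choose Suc k)"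
    using prime_dvd_prime_power_choose[OF assms(1), of "Suc k" n] Suc.prems by simp
  then have "[int ((p ^ n - 1) choose k) + int ((p ^ n - 1) choose Suc k) = 0] (mod int p)"
    unfolding pascal by (simp add: cong_0_iff)
  from cong_diff[OF this Suc.IH] Suc.prems show ?case by simp
qed

text \<open>Absorption leaves \<open>p\<close> times an entry of row p^2 - 1 at the even index
  \<open>p - 1\<close>, which is 1 modulo \<open>p\<close>; the outer factor \<open>p\<close> lifts
  this to p^2.\<close>

lemma odd_prime_square_choose_prime_cong:
  fixes p :: nat
  assumes "prime p" and "odd p"
  shows "[p\<^sup>2 choose p = p] (mod p\<^sup>2)"
proof -
  have p: "p > 1" using assms(1) by (rule prime_gt_1_nat)
  then have "p - 1 < p\<^sup>2" by (simp add: power2_eq_square less_imp_diff_less)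
  from prime_power_minus_one_choose_cong[OF assms(1) this] assms(2) p
  have "[int ((p\<^sup>2 - 1) choose (p - 1)) = int 1] (mod int p)" by simp
  then have "[(p\<^sup>2 - 1) choose (p - 1) = 1] (mod p)" by (simp only: cong_int_iff)
  then have "[p * ((p\<^sup>2 - 1) choose (p - 1)) = p * 1] (mod p * p)"
    by (rule cong_cmult_leftI)
  moreover have "p * (p\<^sup>2 choose p) = p * (p * ((p\<^sup>2 - 1) choose (p - 1)))"
    using times_binomial_minus1_eq[of p "p\<^sup>2"] p by (simp add: power2_eq_square mult.assoc)
  ultimately show ?thesis using p by (simp add: power2_eq_square)
qed

text \<open>The ratio of the binomials is (n^2 - n)(n^2 - n - 1) / ((n + 1)(n + 2)). Splitting off
  \<open>n - 1\<close> from n^2 - n leaves n(n^2 - n - 1) to beat (n + 1)(n + 2).\<close>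

lemma square_choose_add_two_ge:
  fixes n :: nat
  assumes "n \<ge> 5"
  shows "(n - 1) * (n\<^sup>2 choose n) \<le> n\<^sup>2 choose (n + 2)"
proof -
  \<comment> \<open>Writing \<open>n\<close> as \<open>m + 5\<close> removes truncated subtraction
    and lets the inequality be checked coefficientwise.\<close>
  obtain m where m: "n = m + 5" using assms by (metis add.commute le_Suc_ex)
  have step: "Suc k * (n\<^sup>2 choose Suc k) = (n\<^sup>2 - k) * (n\<^sup>2 choose k)" for k
    by (metis binomial_absorb_comp binomial_absorption)
  let ?B = "n\<^sup>2 choose n"
  have "(n + 1) * (n + 2) * (n\<^sup>2 choose (n + 2)) = (n + 1) * ((n\<^sup>2 - (n + 1)) * (n\<^sup>2 choose (n + 1)))"
    using step[of "n + 1"] by (simp only: mult.assoc Suc_eq_plus1 add.assoc one_add_one)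
  also have "\<dots> = (n\<^sup>2 - (n + 1)) * ((n\<^sup>2 - n) * ?B)"
    using step[of n] by (metis Suc_eq_plus1 mult.left_commute)
  finally have prod_eq: "(n + 1) * (n + 2) * (n\<^sup>2 choose (n + 2)) = (n\<^sup>2 - (n + 1)) * (n\<^sup>2 - n) * ?B"
    by (simp add: mult.assoc)
  have d: "n\<^sup>2 - (n + 1) = m * m + 9 * m + 19" "n\<^sup>2 - n = (m + 5) * (n - 1)"
    unfolding m by (simp_all add: power2_eq_square algebra_simps)
  have "(n + 1) * (n + 2) \<le> (n\<^sup>2 - (n + 1)) * (m + 5)"
    unfolding d(1) unfolding m by (simp add: algebra_simps)
  from mult_right_mono[OF this, of "(n - 1) * ?B"]
  have "(n + 1) * (n + 2) * ((n - 1) * ?B) \<le> (n + 1) * (n + 2) * (n\<^sup>2 choose (n + 2))"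
    unfolding prod_eq d by (simp add: mult.assoc)
  then show ?thesis by (simp only: mult_le_cancel1) simp
qed

text \<open>The row increases up to its middle; the upper half reduces to the lower by
  \<open>k\<close> to \<open>n - k\<close>, which preserves the range of \<open>k\<close>.\<close>

lemma square_choose_multiple_ge:
  fixes n k :: nat
  assumes n: "n \<ge> 5" and "2 \<le> k" and "k + 2 \<le> n"
  shows "(n - 1) * (n\<^sup>2 choose n) \<le> n\<^sup>2 choose (n * k)"
proof -
  have base: "(n - 1) * (n\<^sup>2 choose n) \<le> n\<^sup>2 choose (n * j)"
    if "2 \<le> j" "2 * (n * j) \<le> n\<^sup>2" for j
  proof -
    have "n + 2 \<le> n * 2" using n by simp
    also have "\<dots> \<le> n * j" using that(1) by simp
    finally have "n\<^sup>2 choose (n + 2) \<le> n\<^sup>2 choose (n * j)"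
      using that(2) by (intro binomial_mono) auto
    with square_choose_add_two_ge[OF n] show ?thesis by linarith
  qed
  show ?thesis
  proof (cases "2 * (n * k) \<le> n\<^sup>2")
    case True
    then show ?thesis using base assms(2) by blast
  next
    case False
    have le: "n * k \<le> n\<^sup>2" using assms(3) by (simp add: power2_eq_square)
    have eq: "n\<^sup>2 - n * k = n * (n - k)" by (simp add: power2_eq_square diff_mult_distrib2)
    show ?thesis
      using base[of "n - k"] assms(3) False binomial_symmetric[OF le] eq by simp
  qed
qed

theorem corollary4p4:
  fixes p r :: nat
  assumes "prime p" and "odd p" and "0 < r" and "r < p\<^sup>2"
  shows "\<exists>a b :: nat.
           p\<^sup>2 choose r = a * (p\<^sup>2 choose 1) + b * (p\<^sup>2 choose p) \<and>
           [p\<^sup>2 choose r = b * p] (mod p\<^sup>2)"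
proof -
  let ?B = "p\<^sup>2 choose p"
  have p: "p \<ge> 3" using assms(1,2) prime_ge_2_nat[OF assms(1)] by (cases "p = 2") auto
  obtain c where c: "p\<^sup>2 choose r = p * c"
    using prime_dvd_prime_power_choose[OF assms(1,3,4)] by (elim dvdE)
  define b where "b = c mod p"
  have "[p * c = p * b] (mod p * p)"
    unfolding b_def by (intro cong_cmult_leftI) (simp add: cong_def)
  then have cong_bp: "[p\<^sup>2 choose r = b * p] (mod p\<^sup>2)"
    unfolding c by (simp add: power2_eq_square mult.commute)
  have b_unit: "b = 1" if "p\<^sup>2 choose r = ?B"
  proof -
    have "[p * c = p * 1] (mod p * p)"
      using odd_prime_square_choose_prime_cong[OF assms(1,2)] that c
      by (simp add: power2_eq_square)
    then have "[c = 1] (mod p)" using p by (simp add: cong_def mult_mod_right[symmetric])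
    then show ?thesis using p by (simp add: b_def cong_def)
  qed
  have le: "b * ?B \<le> p\<^sup>2 choose r"
  proof (cases "p dvd r")
    case False
    then have "p * p dvd p * c"
      using prime_power_dvd_choose_of_not_dvd[OF assms(1), of r 2] c
      by (simp add: power2_eq_square)
    \<comment> \<open>Here \<open>p\<close> divides \<open>c\<close>, so \<open>b\<close> is
      0.\<close>
    then show ?thesis using p by (simp add: b_def)
  next
    case True
    then obtain k where k: "r = p * k" by (elim dvdE)
    have "0 < k" "k < p" using assms(3,4) k by (auto simp: power2_eq_square)
    then consider "k = 1" | "k = p - 1" | "2 \<le> k" "k + 2 \<le> p" by linarith
    then show ?thesis
    proof cases
      case 1
      then show ?thesis using b_unit k by simp
    next
      case 2
      have "r = p\<^sup>2 - p" using k 2 by (simp add: power2_eq_square diff_mult_distrib2)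
      then have "p\<^sup>2 choose r = ?B"
        using binomial_symmetric[of p "p\<^sup>2"] by (simp add: power2_eq_square)
      then show ?thesis using b_unit by simp
    next
      case 3
      \<comment> \<open>The bounds on \<open>k\<close> give \<open>p\<close> at least 4, and oddness
        excludes 4.\<close>
      have p5: "p \<ge> 5" using 3 assms(2) by (cases "p = 4") auto
      have "b \<le> p - 1" using p mod_less_divisor[of p c] unfolding b_def by linarith
      then have "b * ?B \<le> (p - 1) * ?B" by (rule mult_right_mono) simp
      also have "\<dots> \<le> p\<^sup>2 choose r"
        using square_choose_multiple_ge[of p k] 3 p5 k by simp
      finally show ?thesis .
    qed
  qed
  have "[b * ?B = b * p] (mod p\<^sup>2)"
    using odd_prime_square_choose_prime_cong[OF assms(1,2)] by (rule cong_scalar_left)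
  then have "[p\<^sup>2 choose r = b * ?B] (mod p\<^sup>2)"
    using cong_bp by (metis cong_sym cong_trans)
  \<comment> \<open>By \<open>le\<close> the subtraction does not truncate; since p^2 is
    \<open>p\<^sup>2 choose 1\<close>, the quotient serves as \<open>a\<close>.\<close>
  then have "p\<^sup>2 dvd (p\<^sup>2 choose r) - b * ?B"
    using le by (simp add: cong_altdef_nat)
  then obtain a where "(p\<^sup>2 choose r) - b * ?B = p\<^sup>2 * a" by (elim dvdE)
  then have "p\<^sup>2 choose r = a * (p\<^sup>2 choose 1) + b * ?B"
    using le by (simp add: mult.commute)
  with cong_bp show ?thesis by blast
qed

end
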